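(* Let $S_{1,n-3}$ be the tree with vertices $v_0,\dots,v_{n-1}$ and edges $e_1=\{v_0,v_1\}$, $e_2=\{v_1,v_2\}$, $e_i=\{v_2,v_i\}$ for $3\le i\le n-1$. Let $B_1=\{e_1,\dots,e_{n-1},\{v_0,v_2\},\{v_1,v_3\}\}$ and $B_2=\{e_1,\dots,e_{n-1},\{v_0,v_2\},\{v_3,v_4\}\}$. (1) If $a_0,\dots,a_{n+1}$ are the coefficients of $\det(xI-\mathfrak{D}_2(S_{1,n-3})[B_1,B_1])=\sum_{k}a_kx^k$ and $|a_t|=\max_k|a_k|$, then $\lfloor\frac{n-4}{2}\rfloor\le t\le\lceil\frac{n+4}{2}\rceil$. (2) If $b_0,\dots,b_{n+1}$ are the coefficients of $\det(xI-\mathfrak{D}_2(S_{1,n-3})[B_2,B_2])=\sum_k b_kx^k$ and $|b_t|=\max_k|b_k|$, then $\lfloor\frac{n-4}{2}\rfloor\le t\le\lceil\frac{n+4}{2}\rceil$.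
   Context: For a tree $T$, let $\mathcal{V}_2$ be the set of 2-element vertex subsets (edges regarded as elements of $\mathcal{V}_2$). The 2-Steiner distance matrix $\mathfrak{D}_2(T)$ is indexed by $\mathcal{V}_2$, with entry in row $\{i,j\}$, column $\{k,l\}$ equal to the minimum number of edges of a connected subtree of $T$ whose vertex set contains $i,j,k,l$. $M[B,B]$ denotes the principal submatrix with rows and columns indexed by $B$. *)

theory Defs
  imports "HOL-Combinatorics.Permutations" "HOL-Computational_Algebra.Polynomial" Complex_Main
begin

text \<open>A graph is given by a vertex set VT and a set ET of 2-element vertex subsets (edges).\<close>

definition adj_rel :: "'a set set \<Rightarrow> ('a \<times> 'a) set" where
  "adj_rel F = {(u, v). {u, v} \<in> F}"

text \<open>(V, F) is a connected (sub)graph.\<close>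
definition connected_sub :: "'a set \<Rightarrow> 'a set set \<Rightarrow> bool" where
  "connected_sub V F \<longleftrightarrow> V \<noteq> {} \<and> (\<forall>e\<in>F. e \<subseteq> V) \<and>
     (\<forall>u\<in>V. \<forall>v\<in>V. (u, v) \<in> (adj_rel F)\<^sup>*)"

text \<open>Steiner distance of W in the graph (VT, ET): minimum number of edges of a
  connected subgraph of the graph whose vertex set contains W.\<close>
definition steiner_dist :: "'a set \<Rightarrow> 'a set set \<Rightarrow> 'a set \<Rightarrow> nat" where
  "steiner_dist VT ET W = (LEAST k. \<exists>V F. V \<subseteq> VT \<and> F \<subseteq> ET \<and> finite F \<and>
      connected_sub V F \<and> W \<subseteq> V \<and> card F = k)"

text \<open>2-Steiner distance matrix entry, rows/columns indexed by 2-subsets.\<close>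
definition steiner2 :: "'a set \<Rightarrow> 'a set set \<Rightarrow> 'a set \<Rightarrow> 'a set \<Rightarrow> int" where
  "steiner2 VT ET r c = int (steiner_dist VT ET (r \<union> c))"

text \<open>det(xI - M[B,B]) for a matrix M indexed by the finite set B (Leibniz formula).\<close>
definition charpoly_on :: "'b set \<Rightarrow> ('b \<Rightarrow> 'b \<Rightarrow> int) \<Rightarrow> int poly" where
  "charpoly_on B M = (\<Sum>p | p permutes B. of_int (sign p) *
      (\<Prod>b\<in>B. (if p b = b then [:0, 1:] else 0) - [:M b (p b):]))"

text \<open>The tree S_{1,n-3} on vertices 0..n-1 (v_i = i).\<close>
definition S_verts :: "nat \<Rightarrow> nat set" where
  "S_verts n = {..<n}"

definition S_edges :: "nat \<Rightarrow> nat set set" where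
  "S_edges n = {{0, 1}, {1, 2}} \<union> {{2, i} | i. 3 \<le> i \<and> i < n}"

definition B1 :: "nat \<Rightarrow> nat set set" where
  "B1 n = S_edges n \<union> {{0, 2}, {1, 3}}"

definition B2 :: "nat \<Rightarrow> nat set set" where
  "B2 n = S_edges n \<union> {{0, 2}, {3, 4}}"

end

theory Submission
  imports Defs "Jordan_Normal_Form.Determinant"
begin

text \<open>
  The Steiner distance of a vertex set is the number of edges separating it. Hence all but a few
  leaf edges give the same row of \<open>D + I\<close>, which therefore factors as \<open>P Q\<close> through a space of
  dimension 6. Sylvester's identity \<open>y\<^sup>k det (y I\<^sub>N - P Q) = y\<^sup>N det (y I\<^sub>k - Q P)\<close> with \<open>y = x + 1\<close>
  reduces the characteristic polynomial to \<open>(x + 1)\<^bsup>n - 5\<^esup> q(x)\<close> for an explicit sextic \<open>q\<close>, monic with all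
  other coefficients negative. The coefficients are thus nonnegative combinations of shifted
  binomial coefficients, except for the contribution of \<open>x\<^sup>6\<close>; the latter is absorbed by that of
  \<open>x\<^sup>5\<close>, whose coefficient exceeds \<open>n\<close> in absolute value. Unimodality of the
  binomial coefficients then locates the peak.
\<close>

section \<open>Steiner distances in the tree\<close>

text \<open>Some step of a walk from \<open>X\<close> to its complement has to leave
  \<open>X\<close>. This is the cut argument behind the lower bound on Steiner distances.\<close>

lemma crossing_edge:
  assumes "(u, v) \<in> (adj_rel F)\<^sup>*" "u \<in> X" "v \<notin> X"
  shows "\<exists>a b. {a, b} \<in> F \<and> a \<in> X \<and> b \<notin> X"
  using assms
proof (induction rule: rtrancl_induct)
  case (step y z)
  then show ?case by (cases "y \<in> X") (auto simp: adj_rel_def)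
qed simp

lemma crossing_edge_of_connected:
  assumes "connected_sub V F" "u \<in> V" "v \<in> V" "u \<in> X" "v \<notin> X"
  shows "\<exists>a b. {a, b} \<in> F \<and> a \<in> X \<and> b \<notin> X"
  using crossing_edge[of u v F X] assms by (auto simp: connected_sub_def)

text \<open>For \<open>W\<close> with at least two vertices, these are the edges whose removal
  leaves vertices of \<open>W\<close> on both sides. Cutting a pendant edge isolates its leaf, so
  membership of the leaf in \<open>W\<close> is the whole test; only \<open>{1, 2}\<close> has
  several vertices on each side.\<close>

definition separating_edges :: "nat set \<Rightarrow> nat set set" where
  "separating_edges W = (if 0 \<in> W then {{0, 1}} else {}) \<union>
     (if W \<inter> {0, 1} \<noteq> {} \<and> W \<inter> {2..} \<noteq> {} then {{1, 2}} else {}) \<union> (\<lambda>i. {2, i}) ` (W \<inter> {3..})"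

text \<open>Each edge of the tree is the only edge leaving one of the sets \<open>{0}\<close>,
  \<open>{0, 1}\<close>, \<open>{i}\<close>. A connected subgraph with vertices of \<open>W\<close>
  both inside and outside such a set must cross there, and so contains that edge.\<close>

lemma separating_edges_subset_of_connected:
  assumes "connected_sub V F" "F \<subseteq> S_edges n" "W \<subseteq> V" "\<nexists>a. W \<subseteq> {a}"
  shows "separating_edges W \<subseteq> F"
proof -
  have other: "\<exists>v\<in>W. v \<noteq> a" for a using assms(4) by blast
  have "{0, 1} \<in> F" if W: "0 \<in> W"
  proof -
    obtain v where "v \<in> W" "v \<noteq> 0" using other by blast
    then obtain a b where ab: "{a, b} \<in> F" "a \<in> {0}" "b \<notin> {0}"
      using crossing_edge_of_connected[OF assms(1), of 0 v "{0}"] W assms(3) by auto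
    then have "{a, b} \<in> S_edges n" using assms(2) by blast
    then have "{a, b} = {0, 1}" using ab by (auto simp: S_edges_def doubleton_eq_iff)
    with ab show ?thesis by simp
  qed
  moreover have "{1, 2} \<in> F" if W: "u \<in> W" "u \<in> {0, 1}" "v \<in> W" "v \<in> {2..}" for u v
  proof -
    obtain a b where ab: "{a, b} \<in> F" "a \<in> {0, 1}" "b \<notin> {0, 1}"
      using crossing_edge_of_connected[OF assms(1) subsetD[OF assms(3) W(1)] subsetD[OF assms(3) W(3)] W(2)] W(4) by auto
    then have "{a, b} \<in> S_edges n" using assms(2) by blast
    then have "{a, b} = {1, 2}" using ab by (auto simp: S_edges_def doubleton_eq_iff)
    with ab show ?thesis by simp
  qed
  moreover have "{2, i} \<in> F" if W: "i \<in> W" "3 \<le> i" for i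
  proof -
    obtain v where "v \<in> W" "v \<noteq> i" using other by blast
    then obtain a b where ab: "{a, b} \<in> F" "a \<in> {i}" "b \<notin> {i}"
      using crossing_edge_of_connected[OF assms(1), of i v "{i}"] W assms(3) by auto
    then have "{a, b} \<in> S_edges n" using assms(2) by blast
    then have "{a, b} = {2, i}" using ab W by (auto simp: S_edges_def doubleton_eq_iff)
    with ab show ?thesis by simp
  qed
  ultimately show ?thesis by (auto simp: separating_edges_def)
qed

lemma sym_adj_rel: "sym (adj_rel F)"
  by (simp add: sym_def adj_rel_def insert_commute)

text \<open>Every vertex reaches a common hub, and adjacency is symmetric, so any two vertices are
  joined through it. The hub is 2 if \<open>W\<close> meets \<open>{2..}\<close>; otherwise
  \<open>W\<close> is \<open>{0, 1}\<close> and the hub is 1.\<close>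

lemma connected_separating_edges:
  assumes "\<nexists>a. W \<subseteq> {a}"
  shows "connected_sub (W \<union> \<Union>(separating_edges W)) (separating_edges W)"
proof -
  let ?F = "separating_edges W"
  have "W \<noteq> {}" using assms by auto
  have "\<exists>c. \<forall>v\<in>W \<union> \<Union>?F. (v, c) \<in> (adj_rel ?F)\<^sup>*"
  proof (cases "W \<inter> {2..} = {}")
    case True
    then have "W \<subseteq> {0, 1}" by force
    moreover have "0 \<in> W" using assms calculation by blast
    ultimately have "(0, 1) \<in> adj_rel ?F" "W \<union> \<Union>?F \<subseteq> {0, 1}"
      using True by (auto simp: separating_edges_def adj_rel_def)
    then show ?thesis by (intro exI[of _ 1]) auto
  next
    case False
    have 1: "(1, 2) \<in> adj_rel ?F" if "W \<inter> {0, 1} \<noteq> {}"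
      using that False by (simp add: separating_edges_def adj_rel_def)
    have 0: "(0, 1) \<in> adj_rel ?F" if "0 \<in> W"
      using that by (simp add: separating_edges_def adj_rel_def)
    have "(v, 2) \<in> (adj_rel ?F)\<^sup>*" if v: "v \<in> W \<union> \<Union>?F" for v
    proof -
      consider "v = 0" "0 \<in> W" | "v = 1" "W \<inter> {0, 1} \<noteq> {}" | "v = 2" | "3 \<le> v" "v \<in> W"
      proof -
        have "v = 0 \<or> v = 1 \<or> v = 2 \<or> 3 \<le> v" by linarith
        then show thesis using that v by (auto simp: separating_edges_def split: if_splits)
      qed
      then show ?thesis
      proof cases
        case 1
        then show ?thesis using 0 \<open>W \<inter> {0, 1} \<noteq> {} \<Longrightarrow> (1, 2) \<in> adj_rel ?F\<close>
          by (auto intro: converse_rtrancl_into_rtrancl)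
      next
        case 4
        then have "(v, 2) \<in> adj_rel ?F"
          by (auto simp: separating_edges_def adj_rel_def insert_commute)
        then show ?thesis by blast
      qed (use 1 in auto)
    qed
    then show ?thesis by blast
  qed
  then obtain c where c: "\<And>v. v \<in> W \<union> \<Union>?F \<Longrightarrow> (v, c) \<in> (adj_rel ?F)\<^sup>*" by blast
  have "(c, v) \<in> (adj_rel ?F)\<^sup>*" if "v \<in> W \<union> \<Union>?F" for v
    using c[OF that] sym_rtrancl[OF sym_adj_rel] by (meson symD)
  then show ?thesis
    using c \<open>W \<noteq> {}\<close> unfolding connected_sub_def
    by (blast intro: rtrancl_trans)
qed

lemma steiner_dist_eq_card_separating_edges:
  assumes "W \<subseteq> S_verts n" "\<nexists>a. W \<subseteq> {a}"
  shows "steiner_dist (S_verts n) (S_edges n) W = card (separating_edges W)"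
  unfolding steiner_dist_def
proof (rule Least_equality)
  let ?F = "separating_edges W"
  have fin: "finite W" using assms(1) finite_subset by (auto simp: S_verts_def)
  have F: "?F \<subseteq> S_edges n"
    using assms(1) by (auto simp: separating_edges_def S_edges_def S_verts_def)
  \<comment> \<open>The edge \<open>{0, 1}\<close> may bring in vertex 1 although it is not in
    \<open>W\<close>, so 1 has to be shown to be a vertex of the tree.\<close>
  have "1 < n" if "0 \<in> W"
  proof -
    obtain v where "v \<in> W" "v \<noteq> 0" using assms(2) by blast
    then have "v < n" "1 \<le> v" using assms(1) by (auto simp: S_verts_def)
    then show ?thesis by linarith
  qed
  then have "\<Union>?F \<subseteq> S_verts n"
    using assms(1) by (auto simp: separating_edges_def S_verts_def split: if_splits)
  moreover have "finite ?F" using fin by (simp add: separating_edges_def)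
  ultimately show "\<exists>V F. V \<subseteq> S_verts n \<and> F \<subseteq> S_edges n \<and> finite F \<and> connected_sub V F \<and> W \<subseteq> V \<and> card F = card ?F"
    using assms F connected_separating_edges[OF assms(2)]
    by (intro exI[of _ "W \<union> \<Union>?F"] exI[of _ ?F]) auto
next
  fix k
  assume "\<exists>V F. V \<subseteq> S_verts n \<and> F \<subseteq> S_edges n \<and> finite F \<and> connected_sub V F \<and> W \<subseteq> V \<and> card F = k"
  then show "card (separating_edges W) \<le> k"
    using separating_edges_subset_of_connected assms(2) by (metis card_mono)
qed

lemma card_separating_edges:
  assumes "finite W"
  shows "card (separating_edges W) = of_bool (0 \<in> W) +
    of_bool (W \<inter> {0, 1} \<noteq> {} \<and> W \<inter> {2..} \<noteq> {}) + card (W \<inter> {3..})"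
proof -
  let ?A = "if 0 \<in> W then {{0, 1}} else {} :: nat set set"
  let ?B = "if W \<inter> {0, 1} \<noteq> {} \<and> W \<inter> {2..} \<noteq> {} then {{1, 2}} else {} :: nat set set"
  let ?C = "(\<lambda>i. {2, i}) ` (W \<inter> {3..})"
  \<comment> \<open>Containing 2 but not 1 sets the leaf edges at 2 apart from \<open>{0, 1}\<close>
    and \<open>{1, 2}\<close>, so the three cardinalities add up.\<close>
  have C: "2 \<in> e \<and> 1 \<notin> e" if "e \<in> ?C" for e
    using that by (elim imageE) simp
  have "{0, 1} \<notin> ?C" by (rule notI, drule C) simp
  moreover have "{1, 2} \<notin> ?C" by (rule notI, drule C) simp
  moreover have "{0, 1} \<noteq> {1, 2 :: nat}" by (simp add: doubleton_eq_iff)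
  ultimately have disj: "(?A \<union> ?B) \<inter> ?C = {}" "?A \<inter> ?B = {}" by simp_all
  have "card (?A \<union> ?B \<union> ?C) = card (?A \<union> ?B) + card ?C"
    by (rule card_Un_disjoint) (use assms disj in simp_all)
  also have "card (?A \<union> ?B) = card ?A + card ?B"
    by (rule card_Un_disjoint) (use disj in simp_all)
  also have "card ?C = card (W \<inter> {3..})"
    by (rule card_image) (simp add: inj_on_def doubleton_eq_iff)
  finally show ?thesis by (simp add: separating_edges_def)
qed

lemma steiner2_eq:
  assumes "r \<union> c \<subseteq> S_verts n" "\<nexists>a. r \<union> c \<subseteq> {a}"
  shows "steiner2 (S_verts n) (S_edges n) r c = of_bool (0 \<in> r \<union> c) +
    of_bool ((\<exists>x\<in>r \<union> c. x < 2) \<and> (\<exists>x\<in>r \<union> c. 2 \<le> x)) + int (card ((r \<union> c) \<inter> {3..}))"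
proof -
  have "finite (r \<union> c)" using assms(1) finite_subset by (auto simp: S_verts_def)
  moreover have "(r \<union> c) \<inter> {0, 1} \<noteq> {} \<longleftrightarrow> (\<exists>x\<in>r \<union> c. x < 2)"
    by (auto simp: less_2_cases_iff)
  moreover have "(r \<union> c) \<inter> {2..} \<noteq> {} \<longleftrightarrow> (\<exists>x\<in>r \<union> c. 2 \<le> x)"
    by auto
  ultimately show ?thesis
    unfolding steiner2_def steiner_dist_eq_card_separating_edges[OF assms]
    by (simp add: card_separating_edges)
qed

lemma card_insert_Int_atLeast:
  "finite S \<Longrightarrow> card (insert a S \<inter> {k..}) = of_bool (k \<le> a \<and> a \<notin> S) + card (S \<inter> {k..})"
  for a k :: nat
  by (auto simp: Int_insert_left card_insert_if)

section \<open>Determinants\<close>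

text \<open>Transporting permutations along the enumeration \<open>h\<close> matches the two Leibniz
  sums term by term, because conjugation by \<open>h\<close> preserves signs.\<close>

lemma charpoly_on_eq_det:
  assumes h: "bij_betw h {0..<N} B"
  shows "charpoly_on B M =
    det (mat N N (\<lambda>(i, j). (if i = j then [:0, 1:] else 0) - [:M (h i) (h j):]))"
proof -
  let ?A = "mat N N (\<lambda>(i, j). (if i = j then [:0, 1:] else 0) - [:M (h i) (h j):])"
  have inj: "inj_on h {0..<N}" and img: "h ` {0..<N} = B" using h by (auto simp: bij_betw_def)
  \<comment> \<open>The inverse map is transport along the inverse of \<open>h\<close>.\<close>
  have bij: "bij_betw (map_permutation {0..<N} h) {p. p permutes {0..<N}} {p. p permutes B}"
    by (rule bij_betw_byWitness[where f' = "map_permutation B (inv_into {0..<N} h)"])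
      (use h in \<open>auto intro!: map_permutation_permutes bij_betw_inv_into
         map_permutation_compose_inv[where A = "{0..<N}"] map_permutation_compose_inv[where A = B]
         simp: inv_into_f_f[OF inj] bij_betw_inv_into_right\<close>)
  have "charpoly_on B M = (\<Sum>p | p permutes {0..<N}. of_int (sign (map_permutation {0..<N} h p)) *
      (\<Prod>b\<in>B. (if map_permutation {0..<N} h p b = b then [:0, 1:] else 0) - [:M b (map_permutation {0..<N} h p b):]))"
    unfolding charpoly_on_def by (rule sum.reindex_bij_betw[OF bij, symmetric])
  also have "\<dots> = (\<Sum>p | p permutes {0..<N}. of_int (sign p) * (\<Prod>i = 0..<N. ?A $$ (i, p i)))"
  proof (intro sum.cong refl)
    fix p assume "p \<in> {p. p permutes {0..<N}}"
    then have p: "p permutes {0..<N}" by simp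
    let ?p = "map_permutation {0..<N} h p"
    have "(\<Prod>b\<in>B. (if ?p b = b then [:0, 1:] else 0) - [:M b (?p b):]) =
        (\<Prod>i = 0..<N. (if ?p (h i) = h i then [:0, 1:] else 0) - [:M (h i) (?p (h i)):])"
      by (rule prod.reindex_bij_betw[OF h, symmetric])
    also have "\<dots> = (\<Prod>i = 0..<N. ?A $$ (i, p i))"
    proof (intro prod.cong refl)
      fix i assume i: "i \<in> {0..<N}"
      then have "p i \<in> {0..<N}" using p permutes_in_image by metis
      then show "(if ?p (h i) = h i then [:0, 1:] else 0) - [:M (h i) (?p (h i)):] = ?A $$ (i, p i)"
        using i inj by (auto simp: map_permutation_apply inj_on_eq_iff)
    qed
    moreover have "sign ?p = sign p"
      by (rule sign_map_permutation[OF inj p]) simp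
    ultimately show "of_int (sign ?p) * (\<Prod>b\<in>B. (if ?p b = b then [:0, 1:] else 0) - [:M b (?p b):]) =
        of_int (sign p) * (\<Prod>i = 0..<N. ?A $$ (i, p i))"
      by simp
  qed
  also have "\<dots> = det ?A"
    by (rule det_def'[symmetric]) simp
  finally show ?thesis .
qed

text \<open>Both sides are evaluations of the determinant of the block matrix with rows
  \<open>(y I, P)\<close> and \<open>(Q, I)\<close>.\<close>

lemma det_sylvester:
  fixes y :: "'a :: idom"
  assumes P: "P \<in> carrier_mat N k" and Q: "Q \<in> carrier_mat k N"
  shows "y ^ k * det (y \<cdot>\<^sub>m 1\<^sub>m N - P * Q) = y ^ N * det (y \<cdot>\<^sub>m 1\<^sub>m k - Q * P)"
proof -
  let ?M = "four_block_mat (y \<cdot>\<^sub>m 1\<^sub>m N) P Q (1\<^sub>m k)"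
  let ?L = "four_block_mat (1\<^sub>m N) (0\<^sub>m N k) (- Q) (1\<^sub>m k)"
  let ?R = "four_block_mat (1\<^sub>m N) (- P) (0\<^sub>m k N) (y \<cdot>\<^sub>m 1\<^sub>m k)"
  have M: "?M \<in> carrier_mat (N + k) (N + k)"
    by (intro four_block_carrier_mat) auto
  have L: "?L \<in> carrier_mat (N + k) (N + k)" and R: "?R \<in> carrier_mat (N + k) (N + k)"
    by (intro four_block_carrier_mat; simp)+
  \<comment> \<open>Right multiplication by \<open>?L\<close>, of determinant 1, clears the block
    \<open>Q\<close>.\<close>
  have "?M * ?L = four_block_mat (y \<cdot>\<^sub>m 1\<^sub>m N - P * Q) P (0\<^sub>m k N) (1\<^sub>m k)"
    using P Q by (subst mult_four_block_mat[of _ N N _ k _ k _ _ N _ k])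
      (auto intro!: cong_four_block_mat)
  moreover have "det (four_block_mat (y \<cdot>\<^sub>m 1\<^sub>m N - P * Q) P (0\<^sub>m k N) (1\<^sub>m k)) =
      det (y \<cdot>\<^sub>m 1\<^sub>m N - P * Q) * det (1\<^sub>m k :: 'a mat)"
    by (rule det_four_block_mat_lower_left_zero) (use P Q in auto)
  ultimately have "det ?M * det ?L = det (y \<cdot>\<^sub>m 1\<^sub>m N - P * Q)"
    by (simp flip: det_mult[OF M L])
  moreover have "det ?L = 1"
    using P Q by (subst det_four_block_mat_upper_right_zero[of _ N _ k]) auto
  ultimately have L_eq: "det ?M = det (y \<cdot>\<^sub>m 1\<^sub>m N - P * Q)" by simp
  \<comment> \<open>Right multiplication by \<open>?R\<close>, of determinant \<open>y ^ k\<close>,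
    clears the block \<open>P\<close> instead; no division by \<open>y\<close> occurs.\<close>
  have "?M * ?R = four_block_mat (y \<cdot>\<^sub>m 1\<^sub>m N) (0\<^sub>m N k) Q (y \<cdot>\<^sub>m 1\<^sub>m k - Q * P)"
    using P Q by (subst mult_four_block_mat[of _ N N _ k _ k _ _ N _ k])
      (auto intro!: cong_four_block_mat)
  moreover have "det (four_block_mat (y \<cdot>\<^sub>m 1\<^sub>m N) (0\<^sub>m N k) Q (y \<cdot>\<^sub>m 1\<^sub>m k - Q * P)) =
      det (y \<cdot>\<^sub>m 1\<^sub>m N) * det (y \<cdot>\<^sub>m 1\<^sub>m k - Q * P)"
    by (rule det_four_block_mat_upper_right_zero) (use P Q in auto)
  ultimately have R_eq: "det ?M * det ?R = y ^ N * det (y \<cdot>\<^sub>m 1\<^sub>m k - Q * P)"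
    by (simp flip: det_mult[OF M R])
  have "det ?R = y ^ k"
    using P Q by (subst det_four_block_mat_lower_left_zero[of _ N _ k]) auto
  with L_eq R_eq show ?thesis by (simp add: mult.commute)
qed

text \<open>The large matrix with entries \<open>u (c i) (c j)\<close> factors as
  \<open>P * Q\<close>, where \<open>Q\<close> is the incidence matrix of the classes. In the
  reversed product \<open>Q * P\<close>, summing over the members of a class multiplies row
  \<open>a\<close> of \<open>u\<close> by the size of class \<open>a\<close>.\<close>

lemma det_scalar_minus_blowup:
  fixes y :: "'a :: idom" and u :: "nat \<Rightarrow> nat \<Rightarrow> 'a"
  assumes c: "\<And>i. i < N \<Longrightarrow> c i < k"
  shows "y ^ k * det (mat N N (\<lambda>(i, j). (if i = j then y else 0) - u (c i) (c j))) =
    y ^ N * det (mat k k (\<lambda>(a, b). (if a = b then y else 0) - of_nat (card {i. i < N \<and> c i = a}) * u a b))"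
proof -
  define P where "P = mat N k (\<lambda>(i, a). u (c i) a)"
  define Q where "Q = mat k N (\<lambda>(a, j). if c j = a then 1 else (0 :: 'a))"
  have PQ: "P \<in> carrier_mat N k" "Q \<in> carrier_mat k N" by (auto simp: P_def Q_def)
  have "mat N N (\<lambda>(i, j). (if i = j then y else 0) - u (c i) (c j)) = y \<cdot>\<^sub>m 1\<^sub>m N - P * Q"
  proof (rule eq_matI)
    fix i j assume "i < dim_row (y \<cdot>\<^sub>m 1\<^sub>m N - P * Q)" "j < dim_col (y \<cdot>\<^sub>m 1\<^sub>m N - P * Q)"
    then have ij: "i < N" "j < N" using PQ by auto
    have "(\<Sum>a = 0..<k. u (c i) a * (if c j = a then 1 else 0)) = u (c i) (c j)"
      using c[OF ij(2)] by (subst sum.remove[of _ "c j"]) (auto intro!: sum.neutral)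
    then show "mat N N (\<lambda>(i, j). (if i = j then y else 0) - u (c i) (c j)) $$ (i, j) =
        (y \<cdot>\<^sub>m 1\<^sub>m N - P * Q) $$ (i, j)"
      using ij by (auto simp: P_def Q_def scalar_prod_def)
  qed (use PQ in auto)
  moreover have "mat k k (\<lambda>(a, b). (if a = b then y else 0) - of_nat (card {i. i < N \<and> c i = a}) * u a b) =
      y \<cdot>\<^sub>m 1\<^sub>m k - Q * P"
  proof (rule eq_matI)
    fix a b assume "a < dim_row (y \<cdot>\<^sub>m 1\<^sub>m k - Q * P)" "b < dim_col (y \<cdot>\<^sub>m 1\<^sub>m k - Q * P)"
    then have ab: "a < k" "b < k" using PQ by auto
    have "(\<Sum>i = 0..<N. (if c i = a then 1 else 0) * u (c i) b) = (\<Sum>i | i < N \<and> c i = a. u a b)"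
      by (rule sum.mono_neutral_cong_right) auto
    also have "\<dots> = of_nat (card {i. i < N \<and> c i = a}) * u a b" by simp
    finally show "mat k k (\<lambda>(a, b). (if a = b then y else 0) - of_nat (card {i. i < N \<and> c i = a}) * u a b) $$ (a, b) =
        (y \<cdot>\<^sub>m 1\<^sub>m k - Q * P) $$ (a, b)"
      using ab by (auto simp: P_def Q_def scalar_prod_def)
  qed (use PQ in auto)
  ultimately show ?thesis using det_sylvester[OF PQ] by simp
qed

section \<open>Explicit six by six determinants\<close>

text \<open>Laplace expansion along the first row; \<open>take j v @ drop (Suc j) v\<close> deletes
  column \<open>j\<close>. Iterating it evaluates a determinant given by explicit rows.\<close>

lemma det_mat_of_rows_list_Cons:
  fixes r :: "'a :: comm_ring_1 list"
  assumes "length r = Suc k" "length rs = k" "\<forall>v\<in>set rs. length v = Suc k"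
  shows "det (mat_of_rows_list (Suc k) (r # rs)) =
    (\<Sum>j<Suc k. r ! j * ((-1) ^ j * det (mat_of_rows_list k (map (\<lambda>v. take j v @ drop (Suc j) v) rs))))"
proof -
  let ?A = "mat_of_rows_list (Suc k) (r # rs)"
  have del: "mat_delete ?A 0 j = mat_of_rows_list k (map (\<lambda>v. take j v @ drop (Suc j) v) rs)"
    if "j < Suc k" for j
    using assms that
    by (intro eq_matI) (auto simp: mat_delete_def mat_of_rows_list_def nth_append min_def)
  have "det ?A = (\<Sum>j<Suc k. ?A $$ (0, j) * cofactor ?A 0 j)"
    by (rule laplace_expansion_row) (use assms in \<open>auto simp: mat_of_rows_list_def\<close>)
  also have "\<dots> = (\<Sum>j<Suc k. r ! j * ((-1) ^ j * det (mat_of_rows_list k (map (\<lambda>v. take j v @ drop (Suc j) v) rs))))"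
  proof (intro sum.cong refl)
    fix j assume "j \<in> {..<Suc k}"
    moreover from this have "?A $$ (0, j) = r ! j"
      using assms by (simp add: mat_of_rows_list_def)
    ultimately show "?A $$ (0, j) * cofactor ?A 0 j = r ! j * ((-1) ^ j * det (mat_of_rows_list k (map (\<lambda>v. take j v @ drop (Suc j) v) rs)))"
      by (simp add: cofactor_def del)
  qed
  finally show ?thesis .
qed

lemma det_mat_of_rows_list_Nil: "det (mat_of_rows_list 0 []) = 1"
  by (simp add: det_dim_zero mat_of_rows_list_def)

text \<open>Here \<open>y\<close> stands for \<open>x + 1\<close> and \<open>m\<close> for the size
  of the class of generic leaf edges, which scales the last row.\<close>

lemma det_quotient1:
  fixes y m :: "'a :: comm_ring_1"
  shows "det (mat_of_rows_list 6
   [[y - 2, - 2, - 2, - 3, - 3, - 3],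
    [- 2, y - 2, - 2, - 2, - 2, - 2],
    [- 2, - 2, y - 3, - 3, - 3, - 3],
    [- 3, - 2, - 3, y - 3, - 2, - 3],
    [- 3, - 2, - 3, - 2, y - 2, - 2],
    [- (m * 3), - (m * 2), - (m * 3), - (m * 3), - (m * 2), y - m * 2]]) =
    y^6 - 12*y^5 - 3*y^4 + 22*y^3 - 13*y^2 + 2*y
      + m * (2 - 11*y + 11*y^2 + 10*y^3 - 11*y^4 - 2*y^5)"
  by (simp add: det_mat_of_rows_list_Cons det_mat_of_rows_list_Nil eval_nat_numeral lessThan_Suc)
    (simp add: algebra_simps)

text \<open>As for the first matrix, but the fifth row is doubled: the two leaf edges
  \<open>{2, 3}\<close> and \<open>{2, 4}\<close> form a class of size 2.\<close>

lemma det_quotient2: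
  fixes y m :: "'a :: comm_ring_1"
  shows "det (mat_of_rows_list 6
   [[y - 2, - 2, - 2, - 4, - 3, - 3],
    [- 2, y - 2, - 2, - 3, - 2, - 2],
    [- 2, - 2, y - 3, - 4, - 3, - 3],
    [- 4, - 3, - 4, y - 3, - 2, - 3],
    [- 6, - 4, - 6, - 4, y - 4, - 4],
    [- (m * 3), - (m * 2), - (m * 3), - (m * 3), - (m * 2), y - m * 2]]) =
    y^6 - 14*y^5 - 28*y^4 + 63*y^3 - 28*y^2 + 2*y
      + m * (4 - 21*y + 27*y^2 + 2*y^3 - 11*y^4 - 2*y^5)"
  by (simp add: det_mat_of_rows_list_Cons det_mat_of_rows_list_Nil eval_nat_numeral lessThan_Suc)
    (simp add: algebra_simps)

section \<open>The characteristic polynomials\<close>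

text \<open>The pair \<open>g\<close> is the last element of \<open>B\<^sub>1\<close> or \<open>B\<^sub>2\<close>; leaf edge \<open>e\<^sub>l\<close> gets index \<open>l + 1\<close>.\<close>

definition enum_B :: "nat set \<Rightarrow> nat \<Rightarrow> nat set" where
  "enum_B g i = (if i = 0 then {0, 1} else if i = 1 then {1, 2} else if i = 2 then {0, 2}
     else if i = 3 then g else {2, i - 1})"

lemma bij_betw_enum_B:
  assumes "3 \<le> n" "g \<notin> S_edges n" "g \<noteq> {0, 2}"
  shows "bij_betw (enum_B g) {0..<n + 1} (S_edges n \<union> {{0, 2}, g})"
proof (rule bij_betwI')
  fix i j assume ij: "i \<in> {0..<n + 1}" "j \<in> {0..<n + 1}"
  have g: "g \<noteq> {0, 1}" "g \<noteq> {1, 2}" "\<And>l. 3 \<le> l \<Longrightarrow> l < n \<Longrightarrow> g \<noteq> {2, l}"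
    using assms by (auto simp: S_edges_def)
  have "enum_B g i \<noteq> enum_B g j" if "i < j" "j < n + 1" for i j
  proof -
    have "j = 1 \<or> j = 2 \<or> j = 3 \<or> 4 \<le> j" using that by linarith
    moreover have "i = 0 \<or> i = 1 \<or> i = 2 \<or> i = 3 \<or> 4 \<le> i" by linarith
    ultimately show ?thesis
      using that assms(3) g g(3)[of "j - 1"]
      by (elim disjE) (auto simp: enum_B_def doubleton_eq_iff)
  qed
  then show "enum_B g i = enum_B g j \<longleftrightarrow> i = j"
    using ij by (metis atLeastLessThan_iff linorder_neqE_nat)
next
  fix i assume i: "i \<in> {0..<n + 1}"
  show "enum_B g i \<in> S_edges n \<union> {{0, 2}, g}"
  proof (cases "4 \<le> i")
    case True
    then have "{2, i - 1} \<in> S_edges n"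
      unfolding S_edges_def by (intro UnI2 CollectI exI[of _ "i - 1"]) (use i in auto)
    then show ?thesis using True by (simp add: enum_B_def)
  next
    case False
    then have "i = 0 \<or> i = 1 \<or> i = 2 \<or> i = 3" by linarith
    then show ?thesis by (elim disjE) (simp_all add: enum_B_def S_edges_def)
  qed
next
  fix e assume "e \<in> S_edges n \<union> {{0, 2}, g}"
  then consider "e = {0, 1}" | "e = {1, 2}" | "e = {0, 2}" | "e = g" | l where "3 \<le> l" "l < n" "e = {2, l}"
    by (auto simp: S_edges_def)
  then show "\<exists>i\<in>{0..<n + 1}. e = enum_B g i"
  proof cases
    case 1 then show ?thesis by (intro bexI[of _ 0]) (auto simp: enum_B_def)
  next
    case 2 then show ?thesis using assms by (intro bexI[of _ 1]) (auto simp: enum_B_def)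
  next
    case 3 then show ?thesis using assms by (intro bexI[of _ 2]) (auto simp: enum_B_def)
  next
    case 4 then show ?thesis using assms by (intro bexI[of _ 3]) (auto simp: enum_B_def)
  next
    case 5 then show ?thesis by (intro bexI[of _ "Suc l"]) (auto simp: enum_B_def)
  qed
qed

text \<open>Distinct members of a class need not have the same entry off and on the diagonal: two
  leaf edges are at distance 2, a leaf edge and itself at distance 1. Adding the identity to
  \<open>M\<close> repairs this and turns the variable \<open>x\<close> into
  \<open>x + 1\<close>.\<close>

lemma charpoly_on_blowup:
  assumes h: "bij_betw h {0..<N} B" and c: "\<And>i. i < N \<Longrightarrow> c i < k"
    and M: "\<And>i j. i < N \<Longrightarrow> j < N \<Longrightarrow> M (h i) (h j) = u (c i) (c j) - of_bool (i = j)"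
  shows "[:1, 1:] ^ k * charpoly_on B M = [:1, 1:] ^ N *
    det (mat k k (\<lambda>(a, b). (if a = b then [:1, 1:] else 0) - of_nat (card {i. i < N \<and> c i = a}) * of_int (u a b)))"
proof -
  have "charpoly_on B M = det (mat N N (\<lambda>(i, j). (if i = j then [:1, 1:] else 0) - of_int (u (c i) (c j))))"
    unfolding charpoly_on_eq_det[OF h]
    by (rule arg_cong[where f = det], rule cong_mat) (auto simp: M of_int_poly)
  then show ?thesis
    using det_scalar_minus_blowup[OF c, where y = "[:1, 1:]" and u = "\<lambda>a b. of_int (u a b)"] by simp
qed

text \<open>The rows of \<open>D + I\<close> depend only on the class of their index, and \<open>quotient1\<close>, \<open>quotient2\<close>
  list the entries by classes. All leaf edges whose leaf lies outside the extra pair form one class.\<close>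

definition quotient1 :: "int list list" where
  "quotient1 =
   [[2, 2, 2, 3, 3, 3],
    [2, 2, 2, 2, 2, 2],
    [2, 2, 3, 3, 3, 3],
    [3, 2, 3, 3, 2, 3],
    [3, 2, 3, 2, 2, 2],
    [3, 2, 3, 3, 2, 2]]"

definition quotient2 :: "int list list" where
  "quotient2 =
   [[2, 2, 2, 4, 3, 3],
    [2, 2, 2, 3, 2, 2],
    [2, 2, 3, 4, 3, 3],
    [4, 3, 4, 3, 2, 3],
    [3, 2, 3, 2, 2, 2],
    [3, 2, 3, 3, 2, 2]]"

definition class1 :: "nat \<Rightarrow> nat" where
  "class1 i = min i 5"

text \<open>Indices 4 and 5 are the edges \<open>{2, 3}\<close> and \<open>{2, 4}\<close>, which are
  interchangeable because the extra pair is \<open>{3, 4}\<close>.\<close>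

definition class2 :: "nat \<Rightarrow> nat" where
  "class2 i = (if i < 4 then i else if i < 6 then 4 else 5)"

lemma steiner2_enum_B1:
  assumes "4 \<le> n" "i < n + 1" "j < n + 1"
  shows "steiner2 (S_verts n) (S_edges n) (enum_B {1, 3} i) (enum_B {1, 3} j) =
    quotient1 ! class1 i ! class1 j - of_bool (i = j)"
proof -
  let ?h = "enum_B {1, 3}"
  have h: "?h i \<subseteq> S_verts n" "\<nexists>a. ?h i \<subseteq> {a}" if "i < n + 1" for i
    using assms(1) that by (auto simp: enum_B_def S_verts_def)
  have eq: "steiner2 (S_verts n) (S_edges n) (?h i) (?h j) = of_bool (0 \<in> ?h i \<union> ?h j) +
    of_bool ((\<exists>x\<in>?h i \<union> ?h j. x < 2) \<and> (\<exists>x\<in>?h i \<union> ?h j. 2 \<le> x)) + int (card ((?h i \<union> ?h j) \<inter> {3..}))"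
    by (rule steiner2_eq) (use assms h in blast)+
  \<comment> \<open>Writing a generic index as \<open>Suc l\<close> makes \<open>l\<close> the leaf
    of its edge, so that only finitely many symbolic pairs of edges remain.\<close>
  have "i = 0 \<or> i = 1 \<or> i = 2 \<or> i = 3 \<or> i = 4 \<or> (\<exists>l\<ge>4. i = Suc l)"
    "j = 0 \<or> j = 1 \<or> j = 2 \<or> j = 3 \<or> j = 4 \<or> (\<exists>l\<ge>4. j = Suc l)"
    by presburger+
  then show ?thesis
    unfolding eq
    by (elim disjE exE conjE)
      (simp_all (no_asm_simp) add: enum_B_def quotient1_def class1_def card_insert_Int_atLeast)
qed

lemma steiner2_enum_B2:
  assumes "5 \<le> n" "i < n + 1" "j < n + 1"
  shows "steiner2 (S_verts n) (S_edges n) (enum_B {3, 4} i) (enum_B {3, 4} j) =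
    quotient2 ! class2 i ! class2 j - of_bool (i = j)"
proof -
  let ?h = "enum_B {3, 4}"
  have h: "?h i \<subseteq> S_verts n" "\<nexists>a. ?h i \<subseteq> {a}" if "i < n + 1" for i
    using assms(1) that by (auto simp: enum_B_def S_verts_def)
  have eq: "steiner2 (S_verts n) (S_edges n) (?h i) (?h j) = of_bool (0 \<in> ?h i \<union> ?h j) +
    of_bool ((\<exists>x\<in>?h i \<union> ?h j. x < 2) \<and> (\<exists>x\<in>?h i \<union> ?h j. 2 \<le> x)) + int (card ((?h i \<union> ?h j) \<inter> {3..}))"
    by (rule steiner2_eq) (use assms h in blast)+
  have "i = 0 \<or> i = 1 \<or> i = 2 \<or> i = 3 \<or> i = 4 \<or> i = 5 \<or> (\<exists>l\<ge>5. i = Suc l)"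
    "j = 0 \<or> j = 1 \<or> j = 2 \<or> j = 3 \<or> j = 4 \<or> j = 5 \<or> (\<exists>l\<ge>5. j = Suc l)"
    by presburger+
  then show ?thesis
    unfolding eq
    by (elim disjE exE conjE)
      (simp_all (no_asm_simp) add: enum_B_def quotient2_def class2_def card_insert_Int_atLeast card_insert_if)
qed

lemma less_6_cases:
  assumes "(a :: nat) < 6"
  obtains "a = 0" | "a = 1" | "a = 2" | "a = 3" | "a = 4" | "a = 5"
  using assms by linarith

lemma one_plus_X_powers:
  "[:1, 1 :: int:] ^ 2 = [:1, 2, 1:]" "[:1, 1 :: int:] ^ 3 = [:1, 3, 3, 1:]"
  "[:1, 1 :: int:] ^ 4 = [:1, 4, 6, 4, 1:]" "[:1, 1 :: int:] ^ 5 = [:1, 5, 10, 10, 5, 1:]"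
  "[:1, 1 :: int:] ^ 6 = [:1, 6, 15, 20, 15, 6, 1:]"
  by (simp_all add: eval_nat_numeral)

text \<open>The factor \<open>[:1, 1:] ^ 6\<close> stays on the left because the exponent
  \<open>n - 5\<close> would be negative at \<open>n = 4\<close>. There the class of generic leaf
  edges is empty.\<close>

lemma charpoly_B1:
  assumes "4 \<le> n"
  shows "[:1, 1:] ^ 6 * charpoly_on (B1 n) (steiner2 (S_verts n) (S_edges n)) = [:1, 1:] ^ (n + 1) *
    [:- (int n - 1), - (13 * int n - 28), - (45 * int n - 110), - (54 * int n - 126), - (21 * int n - 36),
      - (2 * int n - 2), 1:]"
proof -
  let ?y = "[:1, 1:] :: int poly" and ?m = "of_nat (n - 4) :: int poly"
  have bij: "bij_betw (enum_B {1, 3}) {0..<n + 1} (B1 n)"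
    unfolding B1_def using assms
    by (intro bij_betw_enum_B) (auto simp: S_edges_def doubleton_eq_iff)
  define s where "s a = (of_nat (card {i. i < n + 1 \<and> class1 i = a}) :: int poly)" for a
  have s: "s a = 1" if "a < 5" for a
  proof -
    have "{i. i < n + 1 \<and> class1 i = a} = {a}" using that assms by (auto simp: class1_def)
    then show ?thesis by (simp add: s_def)
  qed
  have s5: "s 5 = ?m"
  proof -
    have "{i. i < n + 1 \<and> class1 i = 5} = {5..<n + 1}" using assms by (auto simp: class1_def)
    then show ?thesis by (simp add: s_def)
  qed
  have "?y ^ 6 * charpoly_on (B1 n) (steiner2 (S_verts n) (S_edges n)) =
      ?y ^ (n + 1) * det (mat 6 6 (\<lambda>(a, b). (if a = b then ?y else 0) - s a * of_int (quotient1 ! a ! b)))"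
    unfolding s_def
    by (rule charpoly_on_blowup[OF bij])
      (simp add: class1_def, rule steiner2_enum_B1[OF assms], assumption+)
  also have "mat 6 6 (\<lambda>(a, b). (if a = b then ?y else 0) - s a * of_int (quotient1 ! a ! b)) =
    mat_of_rows_list 6
     [[?y - 2, - 2, - 2, - 3, - 3, - 3],
      [- 2, ?y - 2, - 2, - 2, - 2, - 2],
      [- 2, - 2, ?y - 3, - 3, - 3, - 3],
      [- 3, - 2, - 3, ?y - 3, - 2, - 3],
      [- 3, - 2, - 3, - 2, ?y - 2, - 2],
      [- (?m * 3), - (?m * 2), - (?m * 3), - (?m * 3), - (?m * 2), ?y - ?m * 2]]" (is "?L = ?R")
  proof (rule eq_matI)
    fix a b assume "a < dim_row ?R" "b < dim_col ?R"
    then have "a < 6" "b < 6" by (simp_all add: mat_of_rows_list_def)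
    then show "?L $$ (a, b) = ?R $$ (a, b)"
      by (elim less_6_cases)
        (simp_all (no_asm_simp) add: mat_of_rows_list_def quotient1_def s s5)
  qed (simp_all add: mat_of_rows_list_def)
  also have "det ?R = [:- (int n - 1), - (13 * int n - 28), - (45 * int n - 110), - (54 * int n - 126), - (21 * int n - 36),
      - (2 * int n - 2), 1:]"
  proof -
    have m: "?m = [:int n - 4:]" using assms by (simp add: of_nat_poly of_nat_diff)
    show ?thesis
      unfolding det_quotient1 one_plus_X_powers m by (simp add: numeral_poly)
  qed
  finally show ?thesis .
qed

lemma charpoly_B2:
  assumes "5 \<le> n"
  shows "[:1, 1:] ^ 6 * charpoly_on (B2 n) (steiner2 (S_verts n) (S_edges n)) = [:1, 1:] ^ (n + 1) *
    [:- (int n - 1), - (15 * int n - 34), - (53 * int n - 133), - (62 * int n - 141), - (21 * int n - 22),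
      - (2 * int n - 2), 1:]"
proof -
  let ?y = "[:1, 1:] :: int poly" and ?m = "of_nat (n - 5) :: int poly"
  have bij: "bij_betw (enum_B {3, 4}) {0..<n + 1} (B2 n)"
    unfolding B2_def using assms
    by (intro bij_betw_enum_B) (auto simp: S_edges_def doubleton_eq_iff)
  define s where "s a = (of_nat (card {i. i < n + 1 \<and> class2 i = a}) :: int poly)" for a
  have s: "s a = 1" if "a < 4" for a
  proof -
    have "{i. i < n + 1 \<and> class2 i = a} = {a}" using that assms by (auto simp: class2_def)
    then show ?thesis by (simp add: s_def)
  qed
  have s4: "s 4 = 2"
  proof -
    have "{i. i < n + 1 \<and> class2 i = 4} = {4, 5}" using assms by (auto simp: class2_def)
    then show ?thesis by (simp add: s_def)
  qed
  have s5: "s 5 = ?m"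
  proof -
    have "{i. i < n + 1 \<and> class2 i = 5} = {6..<n + 1}" using assms by (auto simp: class2_def)
    then show ?thesis by (simp add: s_def)
  qed
  have "?y ^ 6 * charpoly_on (B2 n) (steiner2 (S_verts n) (S_edges n)) =
      ?y ^ (n + 1) * det (mat 6 6 (\<lambda>(a, b). (if a = b then ?y else 0) - s a * of_int (quotient2 ! a ! b)))"
    unfolding s_def
    by (rule charpoly_on_blowup[OF bij])
      (simp add: class2_def, rule steiner2_enum_B2[OF assms], assumption+)
  also have "mat 6 6 (\<lambda>(a, b). (if a = b then ?y else 0) - s a * of_int (quotient2 ! a ! b)) =
    mat_of_rows_list 6
     [[?y - 2, - 2, - 2, - 4, - 3, - 3],
      [- 2, ?y - 2, - 2, - 3, - 2, - 2],
      [- 2, - 2, ?y - 3, - 4, - 3, - 3],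
      [- 4, - 3, - 4, ?y - 3, - 2, - 3],
      [- 6, - 4, - 6, - 4, ?y - 4, - 4],
      [- (?m * 3), - (?m * 2), - (?m * 3), - (?m * 3), - (?m * 2), ?y - ?m * 2]]" (is "?L = ?R")
  proof (rule eq_matI)
    fix a b assume "a < dim_row ?R" "b < dim_col ?R"
    then have "a < 6" "b < 6" by (simp_all add: mat_of_rows_list_def)
    then show "?L $$ (a, b) = ?R $$ (a, b)"
      by (elim less_6_cases)
        (simp_all (no_asm_simp) add: mat_of_rows_list_def quotient2_def s s4 s5)
  qed (simp_all add: mat_of_rows_list_def)
  also have "det ?R = [:- (int n - 1), - (15 * int n - 34), - (53 * int n - 133), - (62 * int n - 141), - (21 * int n - 22),
      - (2 * int n - 2), 1:]"
  proof -
    have m: "?m = [:int n - 5:]" using assms by (simp add: of_nat_poly of_nat_diff)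
    show ?thesis
      unfolding det_quotient2 one_plus_X_powers m by (simp add: numeral_poly)
  qed
  finally show ?thesis .
qed

section \<open>The peak of the coefficients\<close>

text \<open>Extension by zero to negative indices lets shifted coefficients be written uniformly,
  also near index 0; \<open>bin\<close> follows the same convention.\<close>

definition coeff_int :: "int poly \<Rightarrow> int \<Rightarrow> int" where
  "coeff_int p k = (if k < 0 then 0 else coeff p (nat k))"

lemma coeff_int_of_nat: "coeff_int p (int k) = coeff p k"
  by (simp add: coeff_int_def)

lemma coeff_int_pCons_mult:
  "coeff_int (pCons a p * q) k = a * coeff_int q k + coeff_int (p * q) (k - 1)"
proof (cases "k \<le> 0")
  case True
  then show ?thesis by (auto simp: coeff_int_def)
next
  case False
  then have "nat k = Suc (nat (k - 1))" by auto
  with False show ?thesis by (simp add: coeff_int_def)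
qed

definition bin :: "nat \<Rightarrow> int \<Rightarrow> int" where
  "bin N k = (if k < 0 then 0 else int (N choose nat k))"

lemma coeff_int_one_plus_X_power: "coeff_int ([:1, 1:] ^ N) k = bin N k"
proof (cases "k < 0 \<or> nat k \<le> N")
  case True
  then show ?thesis
    by (auto simp: coeff_int_def bin_def coeff_linear_poly_power)
next
  case False
  moreover have "degree ([:1, 1::int:] ^ N) \<le> N"
    using degree_power_le[of "[:1, 1::int:]" N] by simp
  ultimately show ?thesis
    by (auto simp: coeff_int_def bin_def coeff_eq_0)
qed

lemma bin_nonneg: "0 \<le> bin N k"
  by (simp add: bin_def)

lemma bin_pos: "0 \<le> k \<Longrightarrow> k \<le> int N \<Longrightarrow> 0 < bin N k"
  by (simp add: bin_def)

lemma bin_eq_0: "k < 0 \<or> int N < k \<Longrightarrow> bin N k = 0"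
  by (auto simp: bin_def)

text \<open>The absorption identity, extended to all integers \<open>k\<close>. It gives the ratio
  of neighbouring binomials and hence all the monotonicity facts.\<close>

lemma bin_Suc: "(k + 1) * bin N (k + 1) = (int N - k) * bin N k"
proof (cases "k < 0 \<or> int N < k")
  case True
  \<comment> \<open>At \<open>k = -1\<close> the value \<open>bin N (k + 1)\<close> is 1, but its
    factor \<open>k + 1\<close> vanishes.\<close>
  then show ?thesis by (cases "k = -1") (auto simp: bin_eq_0)
next
  case False
  define j where "j = nat k"
  have j: "k = int j" "j \<le> N" and Suc_j: "nat (int j + 1) = Suc j"
    using False by (auto simp: j_def)
  have "Suc j * (N choose Suc j) = (N - j) * (N choose j)"
    using binomial_absorption[of j N] binomial_absorb_comp[of N j] by simp
  then have "int (Suc j * (N choose Suc j)) = int ((N - j) * (N choose j))"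
    by (rule arg_cong)
  then have "(int j + 1) * int (N choose Suc j) = (int N - int j) * int (N choose j)"
    using j(2) unfolding of_nat_mult by (simp add: of_nat_diff algebra_simps)
  then show ?thesis
    unfolding j(1) bin_def Suc_j by simp
qed

lemma bin_mono: "2 * k + 1 \<le> int N \<Longrightarrow> bin N k \<le> bin N (k + 1)"
proof (cases "k < 0")
  case False
  assume "2 * k + 1 \<le> int N"
  then have "(k + 1) * bin N k \<le> (int N - k) * bin N k"
    by (intro mult_right_mono bin_nonneg) auto
  then show ?thesis using False bin_Suc[of k N] mult_le_cancel_left_pos[of "k + 1" "bin N k" "bin N (k + 1)"] by simp
qed (simp add: bin_eq_0 bin_nonneg)

text \<open>Compare the two factors in \<open>bin_Suc\<close>. The rise from 0 to 1 at
  \<open>k = -1\<close> is included, which covers index 0 in the peak argument.\<close>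

lemma bin_strict_mono: "0 \<le> k + 1 \<Longrightarrow> 2 * k + 1 < int N \<Longrightarrow> bin N k < bin N (k + 1)"
proof (cases "k < 0")
  case False
  assume "2 * k + 1 < int N"
  then have "(k + 1) * bin N k < (int N - k) * bin N k"
    using False by (intro mult_strict_right_mono bin_pos) auto
  then show ?thesis using False bin_Suc[of k N] mult_less_cancel_left_pos[of "k + 1" "bin N k" "bin N (k + 1)"] by simp
qed (auto simp: bin_eq_0 bin_pos)

lemma bin_antimono: "int N \<le> 2 * k + 1 \<Longrightarrow> bin N (k + 1) \<le> bin N k"
proof (cases "k \<le> int N")
  case True
  assume *: "int N \<le> 2 * k + 1"
  then have "(int N - k) * bin N k \<le> (k + 1) * bin N k"
    by (intro mult_right_mono bin_nonneg) auto
  then show ?thesis using True * bin_Suc[of k N] mult_le_cancel_left_pos[of "k + 1" "bin N (k + 1)" "bin N k"]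
    by (cases "k < 0") (auto simp: bin_def)
qed (simp add: bin_eq_0 bin_nonneg)

text \<open>The factors in \<open>bin_Suc\<close> are now ordered the other way. The final drop from
  1 to 0 at \<open>k = int N\<close> is included.\<close>

lemma bin_strict_antimono: "k \<le> int N \<Longrightarrow> int N < 2 * k + 1 \<Longrightarrow> bin N (k + 1) < bin N k"
proof -
  assume *: "k \<le> int N" "int N < 2 * k + 1"
  then have "(int N - k) * bin N k < (k + 1) * bin N k"
    by (intro mult_strict_right_mono bin_pos) auto
  then show ?thesis using * bin_Suc[of k N] mult_less_cancel_left_pos[of "k + 1" "bin N (k + 1)" "bin N k"]
    by auto
qed

text \<open>The coefficients of \<open>(1 + x)\<^sup>N (Q - x)\<close>.\<close>

definition tilted_bin :: "nat \<Rightarrow> int \<Rightarrow> int \<Rightarrow> int" where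
  "tilted_bin N Q k = Q * bin N k - bin N (k - 1)"

lemma bin_pred_le: "k \<le> int N \<Longrightarrow> bin N (k - 1) \<le> int N * bin N k"
proof -
  assume k: "k \<le> int N"
  have "bin N (k - 1) \<le> (int N - (k - 1)) * bin N (k - 1)"
    using mult_right_mono[of 1 "int N - (k - 1)" "bin N (k-1)"] k bin_nonneg by simp
  also have "\<dots> = k * bin N k" using bin_Suc[of "k - 1" N] by simp
  also have "\<dots> \<le> int N * bin N k" by (intro mult_right_mono k bin_nonneg)
  finally show ?thesis .
qed

lemma tilted_bin_nonneg: "int N \<le> Q \<Longrightarrow> k \<le> int N \<Longrightarrow> 0 \<le> tilted_bin N Q k"
  using bin_pred_le[of k N] mult_right_mono[of "int N" Q "bin N k"] bin_nonneg[of N k]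
  by (simp add: tilted_bin_def)

text \<open>It suffices that \<open>Q\<close> times the increment of \<open>bin N\<close> at
  \<open>k\<close> is at least \<open>bin N k\<close>. By absorption \<open>k + 1\<close> times that
  increment is \<open>(int N - 2 * k - 1) * bin N k\<close>, where the first factor is at least 1,
  and \<open>Q\<close> exceeds \<open>k + 1\<close>.\<close>

lemma tilted_bin_mono:
  assumes "int N + 1 \<le> Q" "2 * k + 2 \<le> int N"
  shows "tilted_bin N Q k \<le> tilted_bin N Q (k + 1)"
proof (cases "k < 0")
  case True
  then show ?thesis using assms bin_nonneg[of N "k + 1"] by (simp add: tilted_bin_def bin_eq_0)
next
  case False
  have "(k + 1) * bin N k \<le> Q * bin N k"
    using assms False by (intro mult_right_mono bin_nonneg) auto
  also have "\<dots> \<le> Q * ((int N - 2 * k - 1) * bin N k)"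
    using assms False mult_right_mono[of 1 "int N - 2 * k - 1" "bin N k"] bin_nonneg[of N k]
    by (intro mult_left_mono) auto
  also have "\<dots> = Q * ((int N - k) * bin N k - (k + 1) * bin N k)"
    by (simp add: algebra_simps)
  also have "\<dots> = (k + 1) * (Q * bin N (k + 1) - Q * bin N k)"
    unfolding bin_Suc[symmetric] by (simp add: algebra_simps)
  finally have "bin N k \<le> Q * bin N (k + 1) - Q * bin N k"
    using False by simp
  then show ?thesis using bin_nonneg[of N "k - 1"] by (simp add: tilted_bin_def)
qed

text \<open>The decrease of the \<open>Q\<close> part is at least
  \<open>(2 * k + 1 - int N) * bin N k\<close>, by absorption and \<open>k + 1 \<le> Q\<close>. This
  has to pay for the drop from \<open>bin N (k - 1)\<close> to \<open>bin N k\<close>, which enters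
  with the opposite sign.\<close>

lemma tilted_bin_antimono:
  assumes "int N + 1 \<le> Q" "int N \<le> 2 * k + 1" "k \<le> int N"
  shows "tilted_bin N Q (k + 1) \<le> tilted_bin N Q k"
proof (cases "k < 0")
  case True
  then show ?thesis using assms by (auto simp add: tilted_bin_def bin_eq_0)
next
  case False
  let ?X = "bin N k"
  have 1: "bin N (k - 1) - ?X \<le> (2 * k + 1 - int N) * ?X"
  proof (cases "2 * k \<le> int N + 1")
    case True
    then have "bin N (k - 1) \<le> bin N k" using bin_mono[of "k - 1" N] by simp
    moreover have "0 \<le> (2 * k + 1 - int N) * ?X"
      using assms by (intro mult_nonneg_nonneg bin_nonneg) auto
    ultimately show ?thesis by linarith
  next
    \<comment> \<open>Past the peak the drop is nonnegative, so it may be multiplied by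
      \<open>int N - k + 1\<close>, which is at least 1; absorption then evaluates the
      product.\<close>
    case F: False
    have "bin N k \<le> bin N (k - 1)" using bin_antimono[of N "k - 1"] F by simp
    then have "bin N (k - 1) - ?X \<le> (int N - k + 1) * (bin N (k - 1) - ?X)"
      using assms mult_right_mono[of 1 "int N - k + 1" "bin N (k - 1) - ?X"] by simp
    also have "\<dots> = (2 * k - 1 - int N) * ?X" using bin_Suc[of "k - 1" N] by (simp add: algebra_simps)
    also have "\<dots> \<le> (2 * k + 1 - int N) * ?X" by (intro mult_right_mono bin_nonneg) auto
    finally show ?thesis .
  qed
  have "(k + 1) * ((2 * k + 1 - int N) * ?X) \<le> Q * ((2 * k + 1 - int N) * ?X)"
    using assms False by (intro mult_right_mono mult_nonneg_nonneg bin_nonneg) auto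
  also have "\<dots> = Q * ((k + 1) * ?X - (int N - k) * ?X)"
    by (simp add: algebra_simps)
  also have "\<dots> = (k + 1) * (Q * ?X - Q * bin N (k + 1))"
    unfolding bin_Suc[symmetric] by (simp add: algebra_simps)
  finally have "(2 * k + 1 - int N) * ?X \<le> Q * ?X - Q * bin N (k + 1)"
    using False by simp
  with 1 show ?thesis by (simp add: tilted_bin_def)
qed

text \<open>Up to sign the coefficients are the sum \<open>b\<close> of binomial sequences shifted
  by 0 to 4 and a tilted one shifted by 5. All summands rise while
  \<open>2 * k + 1 \<le> int N\<close> and, up to index \<open>N + 5\<close>, fall once
  \<open>2 * k \<ge> int N + 9\<close>. The leading coefficient is treated separately.\<close>

lemma abs_coeff_peak_one_plus_X_power_times:
  fixes N t :: nat and r0 r1 r2 r3 r4 Q :: int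
  defines "p \<equiv> [:1, 1:] ^ N * [:- r0, - r1, - r2, - r3, - r4, - Q, 1:]"
  assumes r: "0 \<le> r0" "0 < r1" "0 \<le> r2" "0 \<le> r3" "0 < r4" and Q: "int N + 2 \<le> Q"
    and t: "t \<le> N + 6" and max: "\<And>k. k \<le> N + 6 \<Longrightarrow> \<bar>coeff p k\<bar> \<le> \<bar>coeff p t\<bar>"
  shows "N \<le> 2 * t" "2 * t \<le> N + 10"
proof -
  define b where "b k = r0 * bin N k + r1 * bin N (k - 1) + r2 * bin N (k - 2) + r3 * bin N (k - 3)
    + r4 * bin N (k - 4) + tilted_bin N Q (k - 5)" for k
  have p: "coeff p k = - b (int k)" for k
  proof -
    have z: "coeff_int 0 j = 0" for j by (simp add: coeff_int_def)
    have "coeff_int p (int k) = - b (int k)"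
      unfolding p_def mult.commute[of "_ ^ N"] b_def tilted_bin_def
      by (simp add: coeff_int_pCons_mult coeff_int_one_plus_X_power z del: mult_pCons_left)
    then show ?thesis by (simp add: coeff_int_of_nat)
  qed
  have b_nonneg: "0 \<le> b k" if "k \<le> int N + 5" for k
    unfolding b_def using r Q that by (intro add_nonneg_nonneg mult_nonneg_nonneg bin_nonneg tilted_bin_nonneg) auto
  show "N \<le> 2 * t"
  proof (rule ccontr)
    assume "\<not> N \<le> 2 * t"
    then have t': "2 * int t + 1 \<le> int N" by simp
    \<comment> \<open>The summand of \<open>r0\<close> may be stationary here, when
      \<open>2 * t + 1 = N\<close>; the one of \<open>r1\<close>, shifted by 1, rises
      strictly.\<close>
    have "r1 * bin N (int t - 1) < r1 * bin N (int t - 1 + 1)"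
      using r t' by (intro mult_strict_left_mono bin_strict_mono) auto
    moreover have "r0 * bin N (int t) \<le> r0 * bin N (int t + 1)"
      "r2 * bin N (int t - 2) \<le> r2 * bin N (int t - 2 + 1)"
      "r3 * bin N (int t - 3) \<le> r3 * bin N (int t - 3 + 1)"
      "r4 * bin N (int t - 4) \<le> r4 * bin N (int t - 4 + 1)"
      by (rule mult_left_mono[OF bin_mono]; use r t' in simp)+
    moreover have "tilted_bin N Q (int t - 5) \<le> tilted_bin N Q (int t - 5 + 1)"
      using Q t' by (intro tilted_bin_mono) auto
    ultimately have "b (int t) < b (int (t + 1))"
      by (simp add: b_def algebra_simps)
    moreover have "0 \<le> b (int t)" using t' by (intro b_nonneg) simp
    moreover have "\<bar>coeff p (t + 1)\<bar> \<le> \<bar>coeff p t\<bar>" using t' by (intro max) simp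
    ultimately show False by (simp add: p)
  qed
  show "2 * t \<le> N + 10"
  proof (rule ccontr)
    assume "\<not> 2 * t \<le> N + 10"
    then have t': "int N + 11 \<le> 2 * int t" by simp
    obtain s where s: "t = Suc s" using t' by (cases t) auto
    have m: "\<bar>coeff p s\<bar> \<le> \<bar>coeff p t\<bar>" using t s by (intro max) simp
    have s0: "0 \<le> b (int s)" using t s by (intro b_nonneg) simp
    show False
    proof (cases "t = N + 6")
      case True
      then have s': "int s = int N + 5" using s by simp
      \<comment> \<open>At index \<open>N + 5\<close> the value of \<open>b\<close> is at least
        \<open>Q - int N\<close>, hence at least 2, while the leading coefficient has absolute value
        1. This is where \<open>Q\<close> must be at least \<open>int N + 2\<close>.\<close>
      have top: "bin N (int N) = 1" "bin N (int N - 1) \<le> int N"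
        using bin_pred_le[of "int N" N] by (auto simp: bin_def)
      have "b (int s) = Q - bin N (int N - 1)" "b (int t) = -1"
        using top unfolding s' True by (simp_all add: b_def tilted_bin_def bin_eq_0)
      then show False using m Q top by (simp add: p)
    next
      case False
      then have le: "int s \<le> int N + 4" "int N + 9 \<le> 2 * int s" using t s t' by auto
      \<comment> \<open>Strictness comes from \<open>r4\<close>: \<open>int s - 4\<close> is at most
        \<open>int N\<close>, whereas the less shifted binomials may already be zero.\<close>
      have "r4 * bin N (int s - 4 + 1) < r4 * bin N (int s - 4)"
        using r le by (intro mult_strict_left_mono bin_strict_antimono) auto
      moreover have "r0 * bin N (int s + 1) \<le> r0 * bin N (int s)"
        "r1 * bin N (int s - 1 + 1) \<le> r1 * bin N (int s - 1)"
        "r2 * bin N (int s - 2 + 1) \<le> r2 * bin N (int s - 2)"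
        "r3 * bin N (int s - 3 + 1) \<le> r3 * bin N (int s - 3)"
        by (rule mult_left_mono[OF bin_antimono]; use r le in simp)+
      moreover have "tilted_bin N Q (int s - 5 + 1) \<le> tilted_bin N Q (int s - 5)"
        using Q le by (intro tilted_bin_antimono) auto
      ultimately have "b (int t) < b (int s)"
        by (simp add: b_def s algebra_simps)
      moreover have "0 \<le> b (int t)" using le s by (intro b_nonneg) simp
      ultimately show False using m by (simp add: p)
    qed
  qed
qed

lemma peak_bounds:
  fixes n t :: nat
  assumes n: "5 \<le> n" and t: "t \<le> n + 1"
    and p: "[:1, 1:] ^ 6 * p = [:1, 1:] ^ (n + 1) * [:- r0, - r1, - r2, - r3, - r4, - Q, 1:]"
    and r: "0 \<le> r0" "0 < r1" "0 \<le> r2" "0 \<le> r3" "0 < r4" "int n - 3 \<le> Q"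
    and max: "\<bar>coeff p t\<bar> = Max {\<bar>coeff p k\<bar> | k. k \<le> n + 1}"
  shows "\<lfloor>(real n - 4) / 2\<rfloor> \<le> int t \<and> int t \<le> \<lceil>(real n + 4) / 2\<rceil>"
proof -
  have "[:1, 1:] ^ (n + 1) = [:1, 1 :: int:] ^ 6 * [:1, 1:] ^ (n - 5)"
    using n by (simp flip: power_add)
  then have "[:1, 1:] ^ 6 * p = [:1, 1:] ^ 6 * ([:1, 1:] ^ (n - 5) * [:- r0, - r1, - r2, - r3, - r4, - Q, 1:])"
    unfolding p by (simp only: mult.assoc)
  then have p': "p = [:1, 1:] ^ (n - 5) * [:- r0, - r1, - r2, - r3, - r4, - Q, 1:]"
    by (simp only: mult_cancel_left) simp
  have "\<bar>coeff p k\<bar> \<le> \<bar>coeff p t\<bar>" if "k \<le> n - 5 + 6" for k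
    unfolding max by (rule Max_ge) (use that n in auto)
  then have "n - 5 \<le> 2 * t" "2 * t \<le> n - 5 + 10"
    unfolding p' using n t r
    by (intro abs_coeff_peak_one_plus_X_power_times[of r0 r1 r2 r3 r4 "n - 5" Q t]; simp)+
  \<comment> \<open>The bounds are \<open>n - 5 \<le> 2 * t\<close> and
    \<open>2 * t \<le> n + 5\<close>; since \<open>t\<close> is an integer, floor and ceiling absorb
    the extra half on each side.\<close>
  then show ?thesis
    using n by (auto simp: floor_le_iff le_ceiling_iff)
qed

theorem theorem5p6:
  fixes n :: nat
  shows
  "(4 \<le> n \<longrightarrow>
     (\<forall>t \<le> n + 1.
        (let a = charpoly_on (B1 n) (steiner2 (S_verts n) (S_edges n)) in
          \<bar>coeff a t\<bar> = Max {\<bar>coeff a k\<bar> | k. k \<le> n + 1} \<longrightarrow>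
          \<lfloor>(real n - 4) / 2\<rfloor> \<le> int t \<and> int t \<le> \<lceil>(real n + 4) / 2\<rceil>)))
   \<and>
   (5 \<le> n \<longrightarrow>
     (\<forall>t \<le> n + 1.
        (let b = charpoly_on (B2 n) (steiner2 (S_verts n) (S_edges n)) in
          \<bar>coeff b t\<bar> = Max {\<bar>coeff b k\<bar> | k. k \<le> n + 1} \<longrightarrow>
          \<lfloor>(real n - 4) / 2\<rfloor> \<le> int t \<and> int t \<le> \<lceil>(real n + 4) / 2\<rceil>)))"
proof (intro conjI impI allI)
  fix t assume n: "4 \<le> n" and t: "t \<le> n + 1"
  define a where "a = charpoly_on (B1 n) (steiner2 (S_verts n) (S_edges n))"
  have "\<lfloor>(real n - 4) / 2\<rfloor> \<le> int t \<and> int t \<le> \<lceil>(real n + 4) / 2\<rceil>"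
    if max: "\<bar>coeff a t\<bar> = Max {\<bar>coeff a k\<bar> | k. k \<le> n + 1}"
  proof (cases "n = 4")
    case True
    \<comment> \<open>For \<open>n = 4\<close> only \<open>[:1, 1:] ^ 5\<close> stands on the right,
      but the sextic is itself divisible by \<open>[:1, 1:]\<close>; the quintic is the
      quotient.\<close>
    have "[:1, 1:] ^ 6 * a = [:1, 1:] ^ 6 * [:-3, -21, -49, -41, -7, 1:]"
      using charpoly_B1[OF n] unfolding a_def True by (simp add: eval_nat_numeral)
    then have a: "a = [:-3, -21, -49, -41, -7, 1:]"
      by (simp only: mult_cancel_left) simp
    \<comment> \<open>The claim for \<open>n = 4\<close> is \<open>0 \<le> t \<le> 4\<close>, so
      only the leading index 5 has to be excluded, and 1 is less than 7.\<close>
    have "\<bar>coeff a 4\<bar> \<le> \<bar>coeff a t\<bar>"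
      unfolding max by (rule Max_ge) (use True in auto)
    then have "t \<noteq> 5"
      unfolding a by (auto simp: eval_nat_numeral)
    then show ?thesis using t True by simp
  next
    case False
    with n have "5 \<le> n" by simp
    then show ?thesis
      by (rule peak_bounds[OF _ t charpoly_B1[OF n, folded a_def] _ _ _ _ _ _ max]) (use n in auto)
  qed
  then show "let a = charpoly_on (B1 n) (steiner2 (S_verts n) (S_edges n)) in
      \<bar>coeff a t\<bar> = Max {\<bar>coeff a k\<bar> | k. k \<le> n + 1} \<longrightarrow>
      \<lfloor>(real n - 4) / 2\<rfloor> \<le> int t \<and> int t \<le> \<lceil>(real n + 4) / 2\<rceil>"
    by (simp add: Let_def a_def)
next
  fix t assume n: "5 \<le> n" and t: "t \<le> n + 1"
  define b where "b = charpoly_on (B2 n) (steiner2 (S_verts n) (S_edges n))"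
  have "\<lfloor>(real n - 4) / 2\<rfloor> \<le> int t \<and> int t \<le> \<lceil>(real n + 4) / 2\<rceil>"
    if max: "\<bar>coeff b t\<bar> = Max {\<bar>coeff b k\<bar> | k. k \<le> n + 1}"
    by (rule peak_bounds[OF n t charpoly_B2[OF n, folded b_def] _ _ _ _ _ _ max]) (use n in auto)
  then show "let b = charpoly_on (B2 n) (steiner2 (S_verts n) (S_edges n)) in
      \<bar>coeff b t\<bar> = Max {\<bar>coeff b k\<bar> | k. k \<le> n + 1} \<longrightarrow>
      \<lfloor>(real n - 4) / 2\<rfloor> \<le> int t \<and> int t \<le> \<lceil>(real n + 4) / 2\<rceil>"
    by (simp add: Let_def b_def)
qed

end
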